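(* Let $\mathbf d=(d_0,d_1,d_2)$ be an architecture with $d_1\ge2$. Define a matrix $\mathbf M$ with (1) rows indexed by $(d_1-1)$-tuples $(\mathbf e_{i_1},\dots,\mathbf e_{i_{d_1-1}})$ of unit vectors of length $d_0$, where $1\le i_1\le\dots\le i_{d_1-1}\le d_0$; (2) columns indexed either by $(k,\mathbf 0)$ for $k=1,\dots,d_2$, corresponding to the numerators of the entries in the parametrization, or by unit vectors $\mathbf e_j$ of length $d_0$, $1\le j\le d_0$. The entry of $\mathbf M$ in the position indexed by $(\mathbf e_{i_1},\dots,\mathbf e_{i_{d_1-1}})$ and $(k,\mathbf 0)$ is $$\frac{d_1!}{|S_{d_1-1}(\{i_1,\dots,i_{d_1-1}\})|}\;C_{k,\mathbf e_{i_1}+\cdots+\mathbf e_{i_{d_1-1}}},$$ and the entry in the position indexed by $(\mathbf e_{i_1},\dots,\mathbf e_{i_{d_1-1}})$ and $\mathbf e_j$ is $$\frac{d_1!}{|S_{d_1}(\{i_1,\dots,i_{d_1-1},j\})|}\;C_{\mathbf e_{i_1}+\cdots+\mathbf e_{i_{d_1-1}}+\mathbf e_j},$$ where $S_r(\cdot)$ is the set of all permutations of a multiset with $r$ elements. The matrix $\mathbf M$ has rank $d_1$.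
   Context: Let $W_1=(a_{ij})$ be a $d_1\times d_0$ matrix and $W_2=(b_{kj})$ a $d_2\times d_1$ matrix, whose entries are regarded as variables in a polynomial ring. Put $\ell_j=(W_1\mathbf x)_j$ and $\hat\ell_j=\prod_{s\ne j}\ell_s$. The shallow rational network $W_2\circ\sigma\circ W_1$, with $\sigma(x)=1/x$ applied entrywise, has $k$-th numerator $P_k=\sum_{j=1}^{d_1}b_{kj}\hat\ell_j$ (homogeneous of degree $d_1-1$ in $\mathbf x$) and common denominator $Q=\ell_1\cdots\ell_{d_1}$ (homogeneous of degree $d_1$ in $\mathbf x$). For $u\in\mathbb N^{d_0}$ with $|u|=d_1-1$, $C_{k,u}$ denotes the coefficient of $\mathbf x^u$ in $P_k$; for $|u|=d_1$, $C_u$ denotes the coefficient of $\mathbf x^u$ in $Q$. Permutations of a multiset are counted as distinct arrangements, e.g. $|S_2(\{1,1\})|=1$ and $|S_2(\{1,2\})|=2$.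
   Formalization: The claim is proved under the added assumptions d_0 ≥ 2 and d_1 ≤ d_0 + d_2; without them it fails, since M has a single row when d_0 = 1 and only d_0 + d_2 columns, so its rank would be less than d_1. *)

theory Defs
  imports
    "Jordan_Normal_Form.DL_Rank"
    "HOL-Library.Poly_Mapping"
    "HOL-Library.Product_Lexorder"
    "HOL-Computational_Algebra.Fraction_Field"
    "HOL-Combinatorics.Multiset_Permutations"
begin

text \<open>
  Multivariate polynomials with variables indexed by \<open>'v\<close> and coefficients in \<open>'a\<close> are
  finitely supported functions from exponent vectors to coefficients. All indices
  (matrix entries, variables) start at \<open>0\<close>.
\<close>

type_synonym ('v, 'a) mpoly = "('v \<Rightarrow>\<^sub>0 nat) \<Rightarrow>\<^sub>0 'a"

definition unit_exp :: "'v \<Rightarrow> ('v \<Rightarrow>\<^sub>0 nat)" where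
  "unit_exp v = Poly_Mapping.single v 1"

definition Var :: "'v \<Rightarrow> ('v, 'a::comm_ring_1) mpoly" where
  "Var v = Poly_Mapping.single (unit_exp v) 1"

definition Const :: "'a \<Rightarrow> ('v, 'a::comm_ring_1) mpoly" where
  "Const c = Poly_Mapping.single 0 c"

subsection \<open>Shallow rational networks over a coefficient ring\<close>

text \<open>In this subsection the input variable \<open>x\<^sub>i\<close> is \<open>Var i\<close>, and \<open>W1\<close>, \<open>W2\<close> are matrices over
  the coefficient ring.\<close>

definition ell :: "'r::comm_ring_1 mat \<Rightarrow> nat \<Rightarrow> (nat, 'r) mpoly" where
  "ell W1 j = (map_mat Const W1 *\<^sub>v vec (dim_col W1) Var) $ j"

definition ell_hat :: "'r::comm_ring_1 mat \<Rightarrow> nat \<Rightarrow> (nat, 'r) mpoly" where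
  "ell_hat W1 j = (\<Prod>s\<in>{..<dim_row W1} - {j}. ell W1 s)"

definition numerator :: "'r::comm_ring_1 mat \<Rightarrow> 'r mat \<Rightarrow> nat \<Rightarrow> (nat, 'r) mpoly" where
  "numerator W1 W2 k = (\<Sum>j<dim_row W1. Const (W2 $$ (k, j)) * ell_hat W1 j)"

definition denominator :: "'r::comm_ring_1 mat \<Rightarrow> (nat, 'r) mpoly" where
  "denominator W1 = (\<Prod>j<dim_row W1. ell W1 j)"

definition exponent_of :: "nat list \<Rightarrow> (nat \<Rightarrow>\<^sub>0 nat)" where
  "exponent_of is = (\<Sum>i\<leftarrow>is. unit_exp i)"

text \<open>The tuple \<open>(e\<^bsub>i\<^sub>1\<^esub>, \<dots>, e\<^bsub>i\<^sub>r\<^esub>)\<close> with \<open>i\<^sub>1 \<le> \<dots> \<le> i\<^sub>r < n\<close> is represented by the list of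
  the \<open>i\<^sub>s\<close>; each such list occurs exactly once.\<close>

definition nondecreasing_tuples :: "nat \<Rightarrow> nat \<Rightarrow> nat list list" where
  "nondecreasing_tuples n r = filter sorted (List.n_lists r [0..<n])"

text \<open>Columns \<open>0, \<dots>, d\<^sub>2 - 1\<close> are those indexed by the numerators; column \<open>d\<^sub>2 + j\<close> is the one
  indexed by the unit vector \<open>e\<^sub>j\<close>. The entries are taken in the fraction field of the coefficient
  ring, where the rank is computed.\<close>

definition coeff_matrix :: "'r::idom mat \<Rightarrow> 'r mat \<Rightarrow> 'r fract mat" where
  "coeff_matrix W1 W2 =
     (let d0 = dim_col W1; d1 = dim_row W1; d2 = dim_row W2;
          rws = nondecreasing_tuples d0 (d1 - 1)
      in mat (length rws) (d2 + d0) (\<lambda>(r, c).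
           let is = rws ! r in
           if c < d2
           then of_nat (fact d1) / of_nat (card (permutations_of_multiset (mset is)))
                * Fraction_Field.Fract
                    (Poly_Mapping.lookup (numerator W1 W2 c) (exponent_of is)) 1
           else let is' = is @ [c - d2] in
                of_nat (fact d1) / of_nat (card (permutations_of_multiset (mset is')))
                * Fraction_Field.Fract
                    (Poly_Mapping.lookup (denominator W1) (exponent_of is')) 1))"

definition mat_rank :: "'f::field mat \<Rightarrow> nat" where
  "mat_rank A = vec_space.rank (dim_row A) A"

subsection \<open>Generic weights\<close>

text \<open>The variable indexed by \<open>(l, i, j)\<close> is the \<open>(i, j)\<close> entry of the \<open>l\<close>-th weight matrix, so
  \<open>a\<^sub>i\<^sub>j\<close> is \<open>Var (1, i, j)\<close> and \<open>b\<^sub>k\<^sub>j\<close> is \<open>Var (2, k, j)\<close>. The index type is infinite, but only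
  the entries of the weight matrices are used. The lexicographic order on indices only serves to
  make the polynomial ring an instance of \<^class>\<open>idom\<close>.\<close>

type_synonym 'a weight_poly = "(nat \<times> nat \<times> nat, 'a) mpoly"

definition generic_W :: "nat \<Rightarrow> nat \<Rightarrow> nat \<Rightarrow> 'a::comm_ring_1 weight_poly mat" where
  "generic_W l m n = mat m n (\<lambda>(i, j). Var (l, i, j))"

definition M_matrix :: "nat \<Rightarrow> nat \<Rightarrow> nat \<Rightarrow> 'a::field_char_0 weight_poly fract mat" where
  "M_matrix d0 d1 d2 = coeff_matrix (generic_W 1 d1 d0) (generic_W 2 d2 d1)"

subsection \<open>Necessity of the bounds on the architecture\<close>

lemma M_matrix_carrier:
  "(M_matrix d0 d1 d2 :: 'a::field_char_0 weight_poly fract mat)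
     \<in> carrier_mat (length (nondecreasing_tuples d0 (d1 - 1))) (d2 + d0)"
  by (simp add: M_matrix_def coeff_matrix_def generic_W_def Let_def)

lemma length_nondecreasing_tuples_le_1:
  assumes "n \<le> 1"
  shows "length (nondecreasing_tuples n r) \<le> 1"
proof -
  have "length (nondecreasing_tuples n r) \<le> n ^ r"
    unfolding nondecreasing_tuples_def using length_filter_le[of sorted "List.n_lists r [0..<n]"]
    by (simp add: length_n_lists)
  also have "\<dots> \<le> 1"
    using power_mono[OF assms, of r] by simp
  finally show ?thesis .
qed

text \<open>The rank of an \<open>m \<times> n\<close> matrix is at most \<open>min m n\<close>; hence rank \<open>d\<^sub>1 \<ge> 2\<close> is impossible for
  \<open>d\<^sub>0 = 1\<close> (a single row) and for \<open>d\<^sub>1 > d\<^sub>0 + d\<^sub>2\<close> (too few columns).\<close>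

lemma rank_M_matrix_eq_imp_bounds:
  assumes "d1 \<ge> 2"
    and "mat_rank (M_matrix d0 d1 d2 :: 'a::field_char_0 weight_poly fract mat) = d1"
  shows "d0 \<ge> 2" "d1 \<le> d0 + d2"
proof -
  let ?M = "M_matrix d0 d1 d2 :: 'a weight_poly fract mat"
  let ?n = "length (nondecreasing_tuples d0 (d1 - 1))"
  have M: "?M \<in> carrier_mat ?n (d2 + d0)" by (rule M_matrix_carrier)
  then have "mat_rank ?M = vec_space.rank ?n ?M" by (simp add: mat_rank_def)
  then have r: "vec_space.rank ?n ?M = d1" using assms by simp
  show "d1 \<le> d0 + d2" using vec_space.rank_le_nc[OF M] r by simp
  interpret vec_space "TYPE('a weight_poly fract)" ?n .
  have "rank ?M \<le> ?n"
  proof -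
    have cols: "set (cols ?M) \<subseteq> carrier_vec ?n" using cols_dim[of ?M] carrier_matD(1)[OF M] by simp
    show ?thesis unfolding rank_def
      using subspace_dim[OF span_is_subspace[OF cols] fin_dim fin_dim_span_cols[OF M]]
      unfolding dim_is_n .
  qed
  then have "d1 \<le> ?n" using r by simp
  then show "d0 \<ge> 2"
    using length_nondecreasing_tuples_le_1[of d0 "d1 - 1"] assms(1) by linarith
qed

end

theory Submission
  imports Defs "Subresultants.More_Homomorphisms"
begin

text \<open>
  Consider the row of \<open>M\<close> that belongs to the monomial \<open>x\<^sup>u\<close> of degree \<open>d\<^sub>1 - 1\<close>. A multiset of size \<open>r\<close>
  with multiplicities \<open>v\<close> has \<open>r! / v!\<close> permutations, so the entry in column \<open>(k, 0)\<close> is \<open>u! d\<^sub>1 [x\<^sup>u] P\<^sub>k\<close>, and the entry in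
  column \<open>e\<^sub>i\<close> is \<open>u! (u\<^sub>i + 1) C\<close> with \<open>C\<close> the coefficient of \<open>x\<^sup>u x\<^sub>i\<close> in \<open>Q\<close>, that is,
  \<open>u!\<close> times the coefficient of \<open>x\<^sup>u\<close> in the partial derivative \<open>\<partial>\<^sub>i Q\<close>. The columns of \<open>M\<close> thus
  represent the polynomials \<open>d\<^sub>1 P\<^sub>k\<close> and \<open>\<partial>\<^sub>i Q\<close>. Both kinds are linear combinations of the \<open>d\<^sub>1\<close>
  products \<open>ell_hat\<close>: the first by definition, the second by the product rule
  \<open>\<partial>\<^sub>i Q = \<Sum>\<^sub>j a\<^sub>j\<^sub>i ell_hat\<^sub>j\<close>. This gives a factorization \<open>M = A B\<close>
  (\<open>coeff_matrix_factorization\<close>) where \<open>A\<close> consists of the weighted coefficients of the \<open>ell_hat\<^sub>j\<close>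
  and \<open>B\<close> is the \<open>d\<^sub>1 \<times> (d\<^sub>2 + d\<^sub>0)\<close> matrix formed by \<open>d\<^sub>1 W\<^sub>2\<^sup>T\<close> and \<open>W\<^sub>1\<close>. In particular the rank
  is at most \<open>d\<^sub>1\<close>.

  For the lower bound, \<open>A\<close> has to be injective and \<open>B\<close> surjective. Injectivity of \<open>A\<close> means that the
  \<open>ell_hat\<^sub>j\<close> are linearly independent. Choose a point where \<open>ell\<^sub>i\<close> vanishes and no other form
  does; evaluation there kills every \<open>ell_hat\<^sub>j\<close> with \<open>j \<noteq> i\<close>, but not \<open>ell_hat\<^sub>i\<close>. Since evaluation is
  a linear functional of the coefficients, these \<open>d\<^sub>1\<close> points form a matrix \<open>E\<close> such that \<open>E A\<close> is diagonal
  and invertible (\<open>eval_ell_hat_root_of_form\<close>). As \<open>d\<^sub>0 \<ge> 2\<close>, such points exist when the forms have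
  pairwise independent coefficient vectors at \<open>x\<^sub>0, x\<^sub>1\<close>. As \<open>d\<^sub>1 \<le> d\<^sub>0 + d\<^sub>2\<close>, the matrix \<open>B\<close> has a leading
  \<open>d\<^sub>1 \<times> d\<^sub>1\<close> block, and if its determinant is nonzero, then so is that of the leading block of
  \<open>E M = (E A) B\<close>, whence \<open>M\<close> has rank at least \<open>d\<^sub>1\<close> (\<open>mat_rank_coeff_matrix\<close>). For generic
  weights both conditions are checked by specializing the weights to zeros and ones.
\<close>

section \<open>Evaluation of multivariate polynomials\<close>

lemma mpoly_induct [case_names zero single add]:
  fixes p :: "'b \<Rightarrow>\<^sub>0 'a::comm_monoid_add"
  assumes "P 0" and "\<And>u c. P (Poly_Mapping.single u c)" and "\<And>p q. P p \<Longrightarrow> P q \<Longrightarrow> P (p + q)"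
  shows "P p"
proof (induction p rule: update_induct)
  case const
  show ?case by (fact assms(1))
next
  case (update f a b)
  have "Poly_Mapping.update a b f = f + Poly_Mapping.single a b"
    using update by (intro poly_mapping_eqI) (auto simp: lookup_update lookup_add lookup_single in_keys_iff when_def)
  then show ?case using update assms by simp
qed

definition eval_monom :: "('v \<Rightarrow> 'a::comm_ring_1) \<Rightarrow> ('v \<Rightarrow>\<^sub>0 nat) \<Rightarrow> 'a" where
  "eval_monom x u = (\<Prod>v\<in>Poly_Mapping.keys u. x v ^ Poly_Mapping.lookup u v)"

definition eval_mpoly :: "('v \<Rightarrow> 'a::comm_ring_1) \<Rightarrow> ('v, 'a) mpoly \<Rightarrow> 'a" where
  "eval_mpoly x p = (\<Sum>u\<in>Poly_Mapping.keys p. Poly_Mapping.lookup p u * eval_monom x u)"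

lemma eval_monom_superset:
  assumes "finite S" "Poly_Mapping.keys u \<subseteq> S"
  shows "eval_monom x u = (\<Prod>v\<in>S. x v ^ Poly_Mapping.lookup u v)"
  unfolding eval_monom_def using assms by (intro prod.mono_neutral_left) (auto simp: in_keys_iff)

lemma eval_monom_add: "eval_monom x (u + v) = eval_monom x u * eval_monom x v"
proof -
  let ?S = "Poly_Mapping.keys u \<union> Poly_Mapping.keys v"
  have "eval_monom x w = (\<Prod>v\<in>?S. x v ^ Poly_Mapping.lookup w v)"
    if "Poly_Mapping.keys w \<subseteq> ?S" for w
    using that by (intro eval_monom_superset) auto
  then show ?thesis
    using keys_add[of u v] by (simp add: lookup_add power_add prod.distrib)
qed

lemma eval_mpoly_superset:
  assumes "finite S" "Poly_Mapping.keys p \<subseteq> S"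
  shows "eval_mpoly x p = (\<Sum>u\<in>S. Poly_Mapping.lookup p u * eval_monom x u)"
  unfolding eval_mpoly_def using assms by (intro sum.mono_neutral_left) (auto simp: in_keys_iff)

lemma eval_mpoly_zero: "eval_mpoly x 0 = 0"
  by (simp add: eval_mpoly_def)

lemma eval_mpoly_single: "eval_mpoly x (Poly_Mapping.single u c) = c * eval_monom x u"
  by (subst eval_mpoly_superset[of "{u}"]) (auto simp: lookup_single)

lemma eval_mpoly_add: "eval_mpoly x (p + q) = eval_mpoly x p + eval_mpoly x q"
proof -
  let ?S = "Poly_Mapping.keys p \<union> Poly_Mapping.keys q"
  have "eval_mpoly x r = (\<Sum>u\<in>?S. Poly_Mapping.lookup r u * eval_monom x u)"
    if "Poly_Mapping.keys r \<subseteq> ?S" for r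
    using that by (intro eval_mpoly_superset) auto
  then show ?thesis
    using keys_add[of p q] by (simp add: lookup_add distrib_right sum.distrib)
qed

lemma eval_mpoly_mult: "eval_mpoly x (p * q) = eval_mpoly x p * eval_mpoly x q"
proof (induction p rule: mpoly_induct)
  case (single u c)
  show ?case
    by (induction q rule: mpoly_induct)
      (simp_all add: eval_mpoly_zero eval_mpoly_single eval_mpoly_add mult_single eval_monom_add
        algebra_simps)
qed (simp_all add: eval_mpoly_zero eval_mpoly_add distrib_right)

lemma eval_mpoly_one: "eval_mpoly x 1 = 1"
  unfolding single_one[symmetric] eval_mpoly_single by (simp add: eval_monom_def)

lemma comm_ring_hom_eval_mpoly: "comm_ring_hom (eval_mpoly x)"
  by unfold_locales
    (simp_all add: eval_mpoly_zero eval_mpoly_one eval_mpoly_add eval_mpoly_mult)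

lemma eval_mpoly_Var: "eval_mpoly x (Var v) = x v"
  by (simp add: Var_def unit_exp_def eval_mpoly_single eval_monom_def)

lemma eval_mpoly_Const: "eval_mpoly x (Const c) = c"
  by (simp add: Const_def eval_mpoly_single eval_monom_def)

section \<open>The product rule and the coefficients of numerators and denominator\<close>

lemma lookup_Const_mult:
  "Poly_Mapping.lookup (Const c * p) u = c * Poly_Mapping.lookup p u"
  by (induction p rule: mpoly_induct)
    (simp_all add: Const_def mult_single lookup_single when_def lookup_add algebra_simps)

lemma lookup_Var_mult:
  "Poly_Mapping.lookup (Var i * p) (u + unit_exp i) = Poly_Mapping.lookup p u"
  by (induction p rule: mpoly_induct)
    (auto simp add: Var_def mult_single lookup_single when_def lookup_add algebra_simps)

text \<open>The operator \<open>x\<^sub>i \<partial>\<^sub>i\<close>. Unlike \<open>\<partial>\<^sub>i\<close>, it acts diagonally on monomials, so its coefficients and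
  its product rule involve no shift of exponents.\<close>

definition euler :: "'v \<Rightarrow> ('v, 'a::comm_ring_1) mpoly \<Rightarrow> ('v, 'a) mpoly" where
  "euler i = Poly_Mapping.mapp (\<lambda>u c. of_nat (Poly_Mapping.lookup u i) * c)"

lemma lookup_euler:
  "Poly_Mapping.lookup (euler i p) u = of_nat (Poly_Mapping.lookup u i) * Poly_Mapping.lookup p u"
  by (simp add: euler_def lookup_mapp when_def in_keys_iff)

lemma euler_zero: "euler i 0 = 0"
  by (intro poly_mapping_eqI) (simp add: lookup_euler)

lemma euler_add: "euler i (p + q) = euler i p + euler i q"
  by (intro poly_mapping_eqI) (simp add: lookup_euler lookup_add algebra_simps)

lemma euler_single:
  "euler i (Poly_Mapping.single u c) = Poly_Mapping.single u (of_nat (Poly_Mapping.lookup u i) * c)"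
  by (intro poly_mapping_eqI) (simp add: lookup_euler lookup_single when_def)

text \<open>By bilinearity it suffices to compare monomials, where the rule says that the exponent of
  \<open>x\<^sub>i\<close> is additive.\<close>

lemma euler_mult: "euler i (p * q) = euler i p * q + p * euler i q"
proof (induction p rule: mpoly_induct)
  case (single u c)
  show ?case
  proof (induction q rule: mpoly_induct)
    case (single v d)
    show ?case
      by (simp add: mult_single euler_single lookup_add single_add[symmetric] algebra_simps)
  qed (simp_all add: euler_zero euler_add algebra_simps)
qed (simp_all add: euler_zero euler_add algebra_simps)

lemma euler_one: "euler i 1 = 0"
  unfolding single_one[symmetric] euler_single by simp

lemma euler_prod:
  assumes "finite S"
  shows "euler i (\<Prod>s\<in>S. f s) = (\<Sum>j\<in>S. euler i (f j) * (\<Prod>s\<in>S - {j}. f s))"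
  using assms
proof (induction S rule: finite_induct)
  case (insert a S)
  have "(\<Prod>s\<in>insert a S - {j}. f s) = f a * (\<Prod>s\<in>S - {j}. f s)" if "j \<in> S" for j
  proof -
    have "insert a S - {j} = insert a (S - {j})" using insert that by auto
    then show ?thesis using insert by simp
  qed
  moreover have "insert a S - {a} = S" using insert by auto
  ultimately show ?case using insert
    by (simp add: euler_mult sum_distrib_left algebra_simps)
qed (simp add: euler_one)

lemma euler_sum: "euler i (sum f S) = (\<Sum>s\<in>S. euler i (f s))"
  by (induction S rule: infinite_finite_induct) (simp_all add: euler_zero euler_add)

lemma euler_Const_mult: "euler i (Const c * p) = Const c * euler i p"
  by (intro poly_mapping_eqI) (simp add: lookup_euler lookup_Const_mult)

lemma euler_Var: "euler i (Var k) = (if k = i then Var i else 0)"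
  by (auto simp: Var_def unit_exp_def euler_single lookup_single)

lemma ell_eq_sum:
  assumes "j < dim_row W1"
  shows "ell W1 j = (\<Sum>k<dim_col W1. Const (W1 $$ (j, k)) * Var k)"
  using assms by (simp add: ell_def scalar_prod_def lessThan_atLeast0)

lemma euler_ell:
  assumes "j < dim_row W1" "i < dim_col W1"
  shows "euler i (ell W1 j) = Const (W1 $$ (j, i)) * Var i"
proof -
  have "euler i (ell W1 j) = (\<Sum>k<dim_col W1. if k = i then Const (W1 $$ (j, i)) * Var i else 0)"
    unfolding ell_eq_sum[OF assms(1)] euler_sum
    by (intro sum.cong) (auto simp: euler_Const_mult euler_Var)
  then show ?thesis using assms by simp
qed

text \<open>This is \<open>\<partial>\<^sub>i Q = \<Sum>\<^sub>j a\<^sub>j\<^sub>i ell_hat\<^sub>j\<close>, read off at \<open>x\<^sup>u\<close>. It is obtained as the coefficient of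
  \<open>x\<^sup>u x\<^sub>i\<close> in \<open>x\<^sub>i \<partial>\<^sub>i Q = \<Sum>\<^sub>j a\<^sub>j\<^sub>i x\<^sub>i ell_hat\<^sub>j\<close>.\<close>

lemma denominator_coeff:
  assumes "i < dim_col W1"
  shows "of_nat (Poly_Mapping.lookup u i + 1) * Poly_Mapping.lookup (denominator W1) (u + unit_exp i)
    = (\<Sum>j<dim_row W1. W1 $$ (j, i) * Poly_Mapping.lookup (ell_hat W1 j) u)"
proof -
  have "of_nat (Poly_Mapping.lookup u i + 1) * Poly_Mapping.lookup (denominator W1) (u + unit_exp i)
    = Poly_Mapping.lookup (euler i (denominator W1)) (u + unit_exp i)"
    by (simp add: lookup_euler lookup_add unit_exp_def)
  also have "euler i (denominator W1)
      = (\<Sum>j<dim_row W1. Const (W1 $$ (j, i)) * (Var i * ell_hat W1 j))"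
    unfolding denominator_def ell_hat_def
    using assms by (subst euler_prod) (auto intro!: sum.cong simp: euler_ell mult.assoc)
  finally show ?thesis
    by (simp add: lookup_sum lookup_Const_mult lookup_Var_mult)
qed

lemma numerator_coeff:
  "Poly_Mapping.lookup (numerator W1 W2 k) u
    = (\<Sum>j<dim_row W1. W2 $$ (k, j) * Poly_Mapping.lookup (ell_hat W1 j) u)"
  by (simp add: numerator_def lookup_sum lookup_Const_mult)

section \<open>Nondecreasing tuples as the monomials of a given degree\<close>

lemma lookup_exponent_of: "Poly_Mapping.lookup (exponent_of is) i = count (mset is) i"
  by (induction "is") (auto simp: exponent_of_def unit_exp_def lookup_add lookup_single when_def)

lemma exponent_of_eq_iff: "exponent_of xs = exponent_of ys \<longleftrightarrow> mset xs = mset ys"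
  by (simp add: poly_mapping_eq_iff fun_eq_iff lookup_exponent_of multiset_eq_iff del: count_mset)

lemma set_nondecreasing_tuples:
  "set (nondecreasing_tuples n r) = {is. length is = r \<and> set is \<subseteq> {..<n} \<and> sorted is}"
  by (auto simp: nondecreasing_tuples_def set_n_lists lessThan_atLeast0)

lemma distinct_nondecreasing_tuples: "distinct (nondecreasing_tuples n r)"
  by (simp add: nondecreasing_tuples_def distinct_n_lists)

lemma inj_on_exponent_of: "inj_on exponent_of (set (nondecreasing_tuples n r))"
proof (rule inj_onI)
  fix xs ys
  assume "xs \<in> set (nondecreasing_tuples n r)" "ys \<in> set (nondecreasing_tuples n r)"
    and "exponent_of xs = exponent_of ys"
  then have "sorted xs" "sorted ys" "mset xs = mset ys"
    by (simp_all add: set_nondecreasing_tuples exponent_of_eq_iff)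
  then show "xs = ys"
    using properties_for_sort[of ys xs] properties_for_sort[of xs xs] by simp
qed

text \<open>Sorting a list does not change its exponent vector.\<close>

lemma exponent_of_image:
  "exponent_of ` set (nondecreasing_tuples n r)
    = exponent_of ` {is. length is = r \<and> set is \<subseteq> {..<n}}"
proof (intro equalityI subsetI)
  fix u assume "u \<in> exponent_of ` {is. length is = r \<and> set is \<subseteq> {..<n}}"
  then obtain xs where "u = exponent_of xs" "length xs = r" "set xs \<subseteq> {..<n}" by auto
  then show "u \<in> exponent_of ` set (nondecreasing_tuples n r)"
    by (intro image_eqI[of _ _ "sort xs"])
      (auto simp: exponent_of_eq_iff set_nondecreasing_tuples)
qed (auto simp: set_nondecreasing_tuples)

lemma keys_ell:
  assumes "j < dim_row W1"
  shows "Poly_Mapping.keys (ell W1 j) \<subseteq> exponent_of ` {is. length is = 1 \<and> set is \<subseteq> {..<dim_col W1}}"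
proof
  fix u assume "u \<in> Poly_Mapping.keys (ell W1 j)"
  then obtain k where k: "k < dim_col W1"
      "u \<in> Poly_Mapping.keys (Const (W1 $$ (j, k)) * Var k :: (nat, 'a) mpoly)"
    unfolding ell_eq_sum[OF assms]
    using keys_sum[of "\<lambda>k. Const (W1 $$ (j, k)) * Var k" "{..<dim_col W1}"]
    by auto
  then have "u = exponent_of [k]"
    by (auto simp: in_keys_iff lookup_Const_mult Var_def lookup_single exponent_of_def when_def
        split: if_splits)
  then show "u \<in> exponent_of ` {is. length is = 1 \<and> set is \<subseteq> {..<dim_col W1}}"
    using k by (intro image_eqI[of _ _ "[k]"]) auto
qed

lemma keys_prod_ell:
  assumes "finite S" "S \<subseteq> {..<dim_row W1}"
  shows "Poly_Mapping.keys (\<Prod>s\<in>S. ell W1 s)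
    \<subseteq> exponent_of ` {is. length is = card S \<and> set is \<subseteq> {..<dim_col W1}}"
  using assms
proof (induction S rule: finite_induct)
  case empty
  then show ?case by (auto simp: exponent_of_def intro!: image_eqI[of _ _ "[]"])
next
  case (insert a S)
  show ?case
  proof
    fix u assume "u \<in> Poly_Mapping.keys (\<Prod>s\<in>insert a S. ell W1 s)"
    then obtain v w where vw: "u = v + w" "v \<in> Poly_Mapping.keys (ell W1 a)"
      "w \<in> Poly_Mapping.keys (\<Prod>s\<in>S. ell W1 s)"
      using keys_mult[of "ell W1 a" "\<Prod>s\<in>S. ell W1 s"] insert by auto
    have "v \<in> exponent_of ` {is. length is = 1 \<and> set is \<subseteq> {..<dim_col W1}}"
      using keys_ell[of a W1] insert vw by blast
    then obtain xs where xs: "v = exponent_of xs" "length xs = 1" "set xs \<subseteq> {..<dim_col W1}" by blast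
    have "w \<in> exponent_of ` {is. length is = card S \<and> set is \<subseteq> {..<dim_col W1}}"
      using insert vw by blast
    then obtain ys where ys: "w = exponent_of ys" "length ys = card S" "set ys \<subseteq> {..<dim_col W1}" by blast
    have "u = exponent_of (xs @ ys)" using vw xs ys by (simp add: exponent_of_def)
    then show "u \<in> exponent_of ` {is. length is = card (insert a S) \<and> set is \<subseteq> {..<dim_col W1}}"
      using xs ys insert by (intro image_eqI[of _ _ "xs @ ys"]) auto
  qed
qed

abbreviation row_tuples :: "'r mat \<Rightarrow> nat list list" where
  "row_tuples W1 \<equiv> nondecreasing_tuples (dim_col W1) (dim_row W1 - 1)"

text \<open>Since \<open>ell_hat\<^sub>j\<close> is homogeneous of degree \<open>d\<^sub>1 - 1\<close> in the first \<open>d\<^sub>0\<close> variables, the rows of the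
  matrix see all of its coefficients.\<close>

lemma keys_ell_hat:
  assumes "j < dim_row W1"
  shows "Poly_Mapping.keys (ell_hat W1 j)
    \<subseteq> exponent_of ` set (row_tuples W1)"
  unfolding ell_hat_def exponent_of_image
  using keys_prod_ell[of "{..<dim_row W1} - {j}" W1] assms by simp

text \<open>As the rows see all coefficients of \<open>ell_hat\<^sub>j\<close>, its value at a point is obtained from its column
  by pairing with a row vector that depends on the point only.\<close>

lemma eval_ell_hat:
  assumes "j < dim_row W1"
  shows "eval_mpoly x (ell_hat W1 j)
    = (\<Sum>r<length (row_tuples W1).
        Poly_Mapping.lookup (ell_hat W1 j) (exponent_of (row_tuples W1 ! r))
        * eval_monom x (exponent_of (row_tuples W1 ! r)))"
proof -
  define rws where "rws = row_tuples W1"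
  let ?f = "\<lambda>u. Poly_Mapping.lookup (ell_hat W1 j) u * eval_monom x u"
  have "eval_mpoly x (ell_hat W1 j) = (\<Sum>u\<in>exponent_of ` set rws. ?f u)"
    unfolding rws_def using keys_ell_hat[OF assms] by (intro eval_mpoly_superset) auto
  also have "\<dots> = (\<Sum>is\<in>set rws. ?f (exponent_of is))"
    unfolding rws_def by (subst sum.reindex[OF inj_on_exponent_of]) simp
  also have "\<dots> = (\<Sum>r<length rws. ?f (exponent_of (rws ! r)))"
    unfolding rws_def
    by (rule sum.reindex_bij_betw[OF bij_betw_nth[OF distinct_nondecreasing_tuples refl refl], symmetric])
  finally show ?thesis by (simp add: rws_def)
qed

section \<open>Rank bounds\<close>

text \<open>Every column of \<open>A * B\<close> lies in the column space of \<open>A\<close>.\<close>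

lemma (in vec_space) rank_mult_le:
  assumes A: "A \<in> carrier_mat n d" and B: "B \<in> carrier_mat d m"
  shows "rank (A * B) \<le> rank A"
proof -
  let ?U = "span (set (cols (A * B)))" and ?W = "span (set (cols A))"
  have AB: "A * B \<in> carrier_mat n m" using A B by simp
  have cA: "set (cols A) \<subseteq> carrier_vec n" using cols_dim[of A] A by simp
  have cAB: "set (cols (A * B)) \<subseteq> carrier_vec n" using cols_dim[of "A * B"] A by simp
  have "set (cols (A * B)) \<subseteq> ?W"
  proof
    fix y assume "y \<in> set (cols (A * B))"
    then obtain j where j: "j < m" "y = col (A * B) j"
      using B by (auto simp: cols_def)
    then have "y = A *\<^sub>v col B j" using col_mult2[OF A B] by simp
    then have "y \<in> col_space A"
      using col_space_eq[OF A] A B j(1) col_dim[of B j] by auto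
    then show "y \<in> ?W" by (simp add: col_space_def)
  qed
  then have sub: "?U \<subseteq> ?W" by (rule span_subsetI[OF cA])
  have "VectorSpace.subspace class_ring ?U (vs ?W)"
    by (rule nested_subspaces[OF span_is_subspace[OF cA] span_is_subspace[OF cAB] sub])
  then show ?thesis unfolding rank_def
    using vectorspace.subspace_dim[OF subspace_is_vs[OF span_is_subspace[OF cA]]]
      fin_dim_span_cols[OF A] fin_dim_span_cols[OF AB] by auto
qed

text \<open>The determinant is that of \<open>E * A'\<close>, where \<open>A'\<close> consists of the first \<open>d\<close> columns of \<open>A\<close>. A linear
  relation between the columns of \<open>A'\<close> would persist after multiplication by \<open>E\<close>.\<close>

lemma (in vec_space) rank_ge_if_det_nonzero:
  assumes A: "A \<in> carrier_mat n m" and E: "E \<in> carrier_mat d n" and "d \<le> m"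
    and det: "det (mat d d (\<lambda>ij. (E * A) $$ ij)) \<noteq> 0"
  shows "d \<le> rank A"
proof -
  define A' where "A' = mat n d (\<lambda>ij. A $$ ij)"
  have A': "A' \<in> carrier_mat n d" by (simp add: A'_def)
  have EA': "E * A' = mat d d (\<lambda>ij. (E * A) $$ ij)"
    using A E \<open>d \<le> m\<close> by (intro eq_matI) (auto simp: A'_def scalar_prod_def)
  have EA'c: "E * A' \<in> carrier_mat d d" using E A' by simp
  have colA': "col A' j = col A j" if "j < d" for j
    using that A \<open>d \<le> m\<close> by (intro eq_vecI) (auto simp: A'_def)
  \<comment> \<open>Linear independence is stated for the set of columns, which loses repetitions; so these
    have to be excluded first.\<close>
  have dist: "distinct (cols A')"
  proof (rule ccontr)
    assume "\<not> distinct (cols A')"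
    then obtain i j where ij: "i \<noteq> j" "i < d" "j < d" "col A' i = col A' j"
      using A' by (auto simp: distinct_conv_nth)
    then have "col (E * A') i = col (E * A') j"
      using col_mult2[OF E A'] by simp
    then show False
      using det_identical_cols[OF EA'c] ij det EA' by auto
  qed
  have "lin_indpt (set (cols A'))"
  proof
    assume "lin_dep (set (cols A'))"
    then obtain v where v: "v \<in> carrier_vec d" "v \<noteq> 0\<^sub>v d" "A' *\<^sub>v v = 0\<^sub>v n"
      using lin_depE[OF A' _ dist] by blast
    then have "(E * A') *\<^sub>v v = 0\<^sub>v d"
      using E A' by (subst assoc_mult_mat_vec[OF E A']) (auto intro!: eq_vecI)
    then show False
      using det_0_iff_vec_prod_zero_field[OF EA'c] v det EA' by auto
  qed
  moreover have "set (cols A') \<subseteq> set (cols A)"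
    using A A' colA' \<open>d \<le> m\<close> by (force simp: cols_def)
  ultimately have "card (set (cols A')) \<le> rank A"
    by (intro rank_ge_card_indpt[OF A])
  then show ?thesis using distinct_card[OF dist] A' by simp
qed

section \<open>Factorization of the coefficient matrix\<close>

lemma of_nat_fract_eq_0_iff:
  "(of_nat n :: 'r::{idom,ring_char_0} fract) = 0 \<longleftrightarrow> n = 0"
  by (simp add: of_nat_fract to_fract_def[symmetric])

text \<open>This is \<open>u!\<close> for the exponent vector \<open>u\<close> of a tuple of length \<open>d - 1\<close>, written as
  \<open>(d - 1)! / |S|\<close> with numerator and denominator multiplied by \<open>d\<close>.\<close>

definition row_weight :: "nat \<Rightarrow> nat list \<Rightarrow> 'r::idom fract" where
  "row_weight d is = of_nat (fact d) / (of_nat d * of_nat (card (permutations_of_multiset (mset is))))"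

lemma card_permutations_of_multiset_ne_0: "card (permutations_of_multiset A) \<noteq> 0"
  by (simp add: permutations_of_multiset_not_empty)

lemma row_weight_ne_0: "d > 0 \<Longrightarrow> (row_weight d is :: 'r::{idom,ring_char_0} fract) \<noteq> 0"
  by (simp add: row_weight_def of_nat_fract_eq_0_iff del: of_nat_fact)

text \<open>Appending \<open>i\<close> to a tuple with exponent vector \<open>u\<close> multiplies \<open>u!\<close> by \<open>u\<^sub>i + 1\<close>, which is the
  factor that differentiation by \<open>x\<^sub>i\<close> produces.\<close>

lemma row_weight_snoc:
  assumes "d > 0" "length is + 1 = d"
  shows "of_nat (fact d) / of_nat (card (permutations_of_multiset (mset (is @ [i]))))
    = (row_weight d is * of_nat (count (mset is) i + 1) :: 'r::{idom,ring_char_0} fract)"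
proof -
  let ?c = "card (permutations_of_multiset (mset is))"
  let ?c' = "card (permutations_of_multiset (mset (is @ [i])))"
  have "?c' * (count (mset is) i + 1) = (size (mset is) + 1) * ?c"
    using card_permutations_of_multiset_insert_aux[of "mset is" i] by simp
  then have "?c' * (count (mset is) i + 1) = d * ?c"
    unfolding size_mset assms(2) .
  then have "(of_nat ?c' * of_nat (count (mset is) i + 1) :: 'r fract) = of_nat d * of_nat ?c"
    unfolding of_nat_mult[symmetric] by (rule arg_cong)
  moreover have "(of_nat ?c' :: 'r fract) \<noteq> 0" "(of_nat ?c :: 'r fract) \<noteq> 0" "(of_nat d :: 'r fract) \<noteq> 0"
    using assms(1) by (simp_all only: of_nat_fract_eq_0_iff card_permutations_of_multiset_ne_0) auto
  ultimately show ?thesis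
    by (simp add: row_weight_def field_simps del: of_nat_fact of_nat_add of_nat_Suc mset_append)
qed

text \<open>Column \<open>j\<close> of the left factor represents \<open>ell_hat\<^sub>j\<close>. The columns of the right factor are the
  coordinates of \<open>d\<^sub>1 P\<^sub>k\<close> and \<open>\<partial>\<^sub>i Q\<close> with respect to the \<open>ell_hat\<^sub>j\<close>; it stays over the coefficient
  ring, so that its minors can be specialized.\<close>

definition left_factor :: "'r::idom mat \<Rightarrow> 'r fract mat" where
  "left_factor W1 = (let rws = row_tuples W1 in
     mat (length rws) (dim_row W1) (\<lambda>(r, j).
       row_weight (dim_row W1) (rws ! r)
       * to_fract (Poly_Mapping.lookup (ell_hat W1 j) (exponent_of (rws ! r)))))"

definition right_factor :: "'r::idom mat \<Rightarrow> 'r mat \<Rightarrow> 'r mat" where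
  "right_factor W1 W2 = mat (dim_row W1) (dim_row W2 + dim_col W1) (\<lambda>(j, c).
     if c < dim_row W2 then of_nat (dim_row W1) * W2 $$ (c, j) else W1 $$ (j, c - dim_row W2))"

lemma coeff_matrix_factorization:
  fixes W1 :: "'r::{idom,ring_char_0} mat"
  assumes "dim_row W1 > 0"
  shows "coeff_matrix W1 W2 = left_factor W1 * map_mat to_fract (right_factor W1 W2)"
proof -
  define d0 d1 d2 where "d0 = dim_col W1" and "d1 = dim_row W1" and "d2 = dim_row W2"
  define rws where "rws = row_tuples W1"
  have d1: "d1 > 0" using assms by (simp add: d1_def)
  note defs = d0_def[symmetric] d1_def[symmetric] d2_def[symmetric] 
    rws_def[symmetric, unfolded One_nat_def d0_def[symmetric] d1_def[symmetric]]
  show ?thesis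
  proof (rule eq_matI)
    fix r c
    assume "r < dim_row (left_factor W1 * map_mat to_fract (right_factor W1 W2))"
      and "c < dim_col (left_factor W1 * map_mat to_fract (right_factor W1 W2))"
    then have r: "r < length rws" and c: "c < d2 + d0"
      by (simp_all add: left_factor_def right_factor_def Let_def defs)
    define "is" where "is = rws ! r"
    have is_in: "is \<in> set rws" using r by (simp add: is_def)
    then have len: "length is + 1 = d1"
      using d1 by (simp add: rws_def d1_def set_nondecreasing_tuples)
    define L where "L j = Poly_Mapping.lookup (ell_hat W1 j) (exponent_of is)" for j
    have rhs: "(left_factor W1 * map_mat to_fract (right_factor W1 W2)) $$ (r, c)
      = row_weight d1 is * to_fract (\<Sum>j<d1. L j * (if c < d2 then of_nat d1 * W2 $$ (c, j) else W1 $$ (j, c - d2)))"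
      using r c by (auto simp: left_factor_def right_factor_def Let_def defs scalar_prod_def
          L_def is_def to_fract_hom.hom_sum sum_distrib_left mult.assoc lessThan_atLeast0
          intro!: sum.cong)
    show "coeff_matrix W1 W2 $$ (r, c) = (left_factor W1 * map_mat to_fract (right_factor W1 W2)) $$ (r, c)"
    proof (cases "c < d2")
      case True
      have "coeff_matrix W1 W2 $$ (r, c) = of_nat (fact d1) / of_nat (card (permutations_of_multiset (mset is)))
          * to_fract (\<Sum>j<d1. W2 $$ (c, j) * L j)"
        using r c True by (simp add: coeff_matrix_def Let_def defs is_def[symmetric]
              to_fract_def[symmetric] numerator_coeff L_def)
      also have "of_nat (fact d1) / of_nat (card (permutations_of_multiset (mset is)))
          = row_weight d1 is * (of_nat d1 :: 'r fract)"
        using d1 by (simp add: row_weight_def of_nat_fract_eq_0_iff)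
      also have "row_weight d1 is * of_nat d1 * to_fract (\<Sum>j<d1. W2 $$ (c, j) * L j)
          = row_weight d1 is * to_fract (of_nat d1 * (\<Sum>j<d1. W2 $$ (c, j) * L j))"
        by (simp add: to_fract_hom.hom_of_nat)
      also have "of_nat d1 * (\<Sum>j<d1. W2 $$ (c, j) * L j)
          = (\<Sum>j<d1. L j * (if c < d2 then of_nat d1 * W2 $$ (c, j) else W1 $$ (j, c - d2)))"
        using True by (simp add: sum_distrib_left mult_ac)
      finally show ?thesis unfolding rhs .
    next
      case False
      define i where "i = c - d2"
      have i: "i < dim_col W1" using c False by (simp add: i_def d0_def)
      have u: "exponent_of (is @ [i]) = exponent_of is + unit_exp i"
        by (simp add: exponent_of_def)
      have "coeff_matrix W1 W2 $$ (r, c) = of_nat (fact d1) / of_nat (card (permutations_of_multiset (mset (is @ [i]))))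
          * to_fract (Poly_Mapping.lookup (denominator W1) (exponent_of (is @ [i])))"
        using r c False by (simp add: coeff_matrix_def Let_def defs is_def[symmetric]
              to_fract_def[symmetric] i_def)
      also have "\<dots> = row_weight d1 is * to_fract (of_nat (count (mset is) i + 1)
          * Poly_Mapping.lookup (denominator W1) (exponent_of is + unit_exp i))"
        unfolding row_weight_snoc[OF d1 len] u
        by (simp add: to_fract_hom.hom_of_nat del: of_nat_add of_nat_Suc)
      also have "of_nat (count (mset is) i + 1)
            * Poly_Mapping.lookup (denominator W1) (exponent_of is + unit_exp i)
          = (\<Sum>j<d1. W1 $$ (j, i) * L j)"
        using denominator_coeff[OF i, of "exponent_of is"]
        by (simp add: lookup_exponent_of d1_def L_def del: of_nat_add of_nat_Suc count_mset)
      also have "\<dots> = (\<Sum>j<d1. L j * (if c < d2 then of_nat d1 * W2 $$ (c, j) else W1 $$ (j, c - d2)))"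
        using False by (simp add: i_def mult.commute)
      finally show ?thesis unfolding rhs .
    qed
  qed (simp_all add: coeff_matrix_def left_factor_def right_factor_def Let_def)
qed

section \<open>Linear independence of the products of all forms but one\<close>

text \<open>The weights of the rows of the left factor are divided out, so that row \<open>i\<close> evaluates at the
  point \<open>x i\<close>.\<close>

definition evaluation_matrix :: "(nat \<Rightarrow> nat \<Rightarrow> 'r) \<Rightarrow> 'r::idom mat \<Rightarrow> 'r fract mat" where
  "evaluation_matrix x W1 = (let rws = row_tuples W1 in
     mat (dim_row W1) (length rws) (\<lambda>(i, r).
       to_fract (eval_monom (x i) (exponent_of (rws ! r))) / row_weight (dim_row W1) (rws ! r)))"

lemma evaluation_matrix_mult_left_factor:
  fixes W1 :: "'r::{idom,ring_char_0} mat"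
  assumes "dim_row W1 > 0"
  shows "evaluation_matrix x W1 * left_factor W1
    = mat (dim_row W1) (dim_row W1) (\<lambda>(i, j). to_fract (eval_mpoly (x i) (ell_hat W1 j)))"
  using assms
  by (intro eq_matI)
    (simp_all add: evaluation_matrix_def left_factor_def Let_def scalar_prod_def eval_ell_hat
      to_fract_hom.hom_sum row_weight_ne_0 lessThan_atLeast0 mult.commute)

text \<open>The point \<open>(a\<^sub>i\<^sub>1, -a\<^sub>i\<^sub>0, 0, 0, \<dots>)\<close> is a root of the linear form \<open>ell W1 i\<close>; the value of
  another form there is a \<open>2 \<times> 2\<close> minor of \<open>W1\<close>.\<close>

definition root_of_form :: "'r::comm_ring_1 mat \<Rightarrow> nat \<Rightarrow> nat \<Rightarrow> 'r" where
  "root_of_form W1 i k = (if k = 0 then W1 $$ (i, 1) else if k = 1 then - W1 $$ (i, 0) else 0)"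

lemma eval_ell_root_of_form:
  assumes "s < dim_row W1" "dim_col W1 \<ge> 2"
  shows "eval_mpoly (root_of_form W1 i) (ell W1 s)
    = W1 $$ (s, 0) * W1 $$ (i, 1) - W1 $$ (s, 1) * W1 $$ (i, 0)"
proof -
  interpret ev: comm_ring_hom "eval_mpoly (root_of_form W1 i)" by (rule comm_ring_hom_eval_mpoly)
  have "eval_mpoly (root_of_form W1 i) (ell W1 s)
      = (\<Sum>k<dim_col W1. W1 $$ (s, k) * root_of_form W1 i k)"
    using assms by (simp add: ell_eq_sum ev.hom_sum eval_mpoly_mult eval_mpoly_Const eval_mpoly_Var)
  also have "\<dots> = (\<Sum>k\<in>{0,1}. W1 $$ (s, k) * root_of_form W1 i k)"
    using assms(2) by (intro sum.mono_neutral_right) (auto simp: root_of_form_def)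
  finally show ?thesis by (simp add: root_of_form_def)
qed

text \<open>Only \<open>ell_hat W1 i\<close> omits the form \<open>ell W1 i\<close>, which vanishes at the chosen point.\<close>

lemma eval_ell_hat_root_of_form:
  fixes W1 :: "'r::idom mat"
  assumes "i < dim_row W1" "j < dim_row W1" "dim_col W1 \<ge> 2"
    and indep: "\<And>s t. s < dim_row W1 \<Longrightarrow> t < dim_row W1 \<Longrightarrow> s \<noteq> t
      \<Longrightarrow> W1 $$ (s, 0) * W1 $$ (t, 1) \<noteq> W1 $$ (s, 1) * W1 $$ (t, 0)"
  shows "eval_mpoly (root_of_form W1 i) (ell_hat W1 j) = 0 \<longleftrightarrow> i \<noteq> j"
proof -
  interpret ev: comm_ring_hom "eval_mpoly (root_of_form W1 i)" by (rule comm_ring_hom_eval_mpoly)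
  have "eval_mpoly (root_of_form W1 i) (ell_hat W1 j)
      = (\<Prod>s\<in>{..<dim_row W1} - {j}. W1 $$ (s, 0) * W1 $$ (i, 1) - W1 $$ (s, 1) * W1 $$ (i, 0))"
    using assms(3) by (simp add: ell_hat_def ev.hom_prod eval_ell_root_of_form)
  then show ?thesis
    using assms(1,2) indep[of _ i] by (auto simp: mult.commute)
qed

lemma det_diagonal_ne_0:
  fixes A :: "'f::idom mat"
  assumes "A \<in> carrier_mat n n" "\<And>i j. i < n \<Longrightarrow> j < n \<Longrightarrow> A $$ (i, j) = 0 \<longleftrightarrow> i \<noteq> j"
  shows "det A \<noteq> 0"
proof -
  have "upper_triangular A" using assms by auto
  then have "det A = prod_list (diag_mat A)" using assms(1) by (rule det_upper_triangular)
  then show ?thesis using assms by (auto simp: diag_mat_def prod_list_zero_iff)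
qed

section \<open>The rank\<close>

text \<open>The hypothesis on \<open>W1\<close> makes \<open>E\<close> times the left factor diagonal and invertible. Multiplication by
  \<open>E\<close> from the left commutes with the restriction to the first \<open>d\<close> columns, so the remaining
  determinant is the product of that of a diagonal matrix and the given minor.\<close>

lemma mat_rank_coeff_matrix:
  fixes W1 W2 :: "'r::{idom,ring_char_0} mat"
  defines "d \<equiv> dim_row W1"
  assumes "d > 0" "dim_col W1 \<ge> 2" "d \<le> dim_row W2 + dim_col W1"
    and indep: "\<And>s t. s < d \<Longrightarrow> t < d \<Longrightarrow> s \<noteq> t
      \<Longrightarrow> W1 $$ (s, 0) * W1 $$ (t, 1) \<noteq> W1 $$ (s, 1) * W1 $$ (t, 0)"
    and minor: "det (mat d d (\<lambda>ij. right_factor W1 W2 $$ ij)) \<noteq> 0"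
  shows "mat_rank (coeff_matrix W1 W2) = d"
proof -
  define n where "n = length (row_tuples W1)"
  define m where "m = dim_row W2 + dim_col W1"
  define E where "E = evaluation_matrix (root_of_form W1) W1"
  define B where "B = map_mat to_fract (right_factor W1 W2)"
  interpret vec_space "TYPE('r fract)" n .
  have E: "E \<in> carrier_mat d n"
    by (simp add: E_def evaluation_matrix_def Let_def d_def n_def)
  have A: "left_factor W1 \<in> carrier_mat n d"
    by (simp add: left_factor_def Let_def d_def n_def)
  have B: "B \<in> carrier_mat d m"
    by (simp add: B_def right_factor_def d_def m_def)
  have M: "coeff_matrix W1 W2 = left_factor W1 * B"
    using coeff_matrix_factorization[of W1 W2] assms(2) by (simp add: B_def d_def)
  have MC: "coeff_matrix W1 W2 \<in> carrier_mat n m"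
    unfolding M using A B by simp
  let ?D = "E * left_factor W1"
  have D: "?D \<in> carrier_mat d d" using E A by simp
  have "det ?D \<noteq> 0"
  proof (rule det_diagonal_ne_0[OF D])
    fix i j assume "i < d" "j < d"
    then show "?D $$ (i, j) = 0 \<longleftrightarrow> i \<noteq> j"
      using assms(2,3) eval_ell_hat_root_of_form[of i W1 j] indep
      unfolding E_def by (subst evaluation_matrix_mult_left_factor) (simp_all add: d_def)
  qed
  moreover define B' where "B' = mat d d (\<lambda>ij. B $$ ij)"
  have "B' = map_mat to_fract (mat d d (\<lambda>ij. right_factor W1 W2 $$ ij))"
    using assms(4) by (intro eq_matI) (auto simp: B'_def B_def right_factor_def d_def)
  then have "det B' \<noteq> 0" using minor by simp
  moreover have B': "B' \<in> carrier_mat d d" by (simp add: B'_def)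
  moreover have "mat d d (\<lambda>ij. (E * coeff_matrix W1 W2) $$ ij) = ?D * B'"
    unfolding M assoc_mult_mat[OF E A B, symmetric]
    using D B assms(4)
    by (intro eq_matI) (auto simp: B'_def m_def scalar_prod_def)
  ultimately have "det (mat d d (\<lambda>ij. (E * coeff_matrix W1 W2) $$ ij)) \<noteq> 0"
    using det_mult[OF D B'] by simp
  then have "d \<le> rank (coeff_matrix W1 W2)"
    using rank_ge_if_det_nonzero[OF MC E] assms(4) by (simp add: m_def)
  moreover have "rank (coeff_matrix W1 W2) \<le> d"
    using rank_mult_le[OF A B] rank_le_nc[OF A] unfolding M by simp
  ultimately show ?thesis using MC by (simp add: mat_rank_def)
qed

theorem proposition4p7:
  fixes d0 d1 d2 :: nat
  assumes "d0 \<ge> 2" and "d1 \<ge> 2" and "d2 \<ge> 1"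
    and "d1 \<le> d0 + d2"
  shows "mat_rank (M_matrix d0 d1 d2 :: 'a::field_char_0 weight_poly fract mat) = d1"
proof -
  let ?W1 = "generic_W 1 d1 d0 :: 'a weight_poly mat"
    and ?W2 = "generic_W 2 d2 d1 :: 'a weight_poly mat"
  have dims: "dim_row ?W1 = d1" "dim_col ?W1 = d0" "dim_row ?W2 = d2" "dim_col ?W2 = d1"
    by (simp_all add: generic_W_def)
  have indep: "?W1 $$ (s, 0) * ?W1 $$ (t, 1) \<noteq> ?W1 $$ (s, 1) * ?W1 $$ (t, 0)"
    if "s < d1" "t < d1" "s \<noteq> t" for s t
  proof
    \<comment> \<open>Setting \<open>a\<^sub>s\<^sub>0 = a\<^sub>t\<^sub>1 = 1\<close> and all other variables to \<open>0\<close> turns the minor into \<open>1\<close>.\<close>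
    let ?ev = "eval_mpoly (\<lambda>v. of_bool (v = (1, s, 0) \<or> v = (1, t, 1))) :: 'a weight_poly \<Rightarrow> 'a"
    assume "?W1 $$ (s, 0) * ?W1 $$ (t, 1) = ?W1 $$ (s, 1) * ?W1 $$ (t, 0)"
    then have "?ev (?W1 $$ (s, 0) * ?W1 $$ (t, 1)) = ?ev (?W1 $$ (s, 1) * ?W1 $$ (t, 0))"
      by simp
    then show False
      using that assms(1) by (simp add: generic_W_def eval_mpoly_mult eval_mpoly_Var)
  qed
  let ?B = "mat d1 d1 (\<lambda>ij. right_factor ?W1 ?W2 $$ ij)"
  have "det ?B \<noteq> 0"
  proof -
    \<comment> \<open>The entries of the block are multiples of distinct variables. Those on the diagonal are set to
      \<open>1\<close>, the others to \<open>0\<close>; the diagonal lies in the part from \<open>W\<^sub>2\<close> for columns below \<open>d\<^sub>2\<close> and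
      continues with the entries of \<open>W\<^sub>1\<close> in positions \<open>(d\<^sub>2 + j, j)\<close>.\<close>
    let ?ev = "eval_mpoly (\<lambda>(l, i, j). of_bool (if l = 2 then i = j else i = d2 + j)) :: 'a weight_poly \<Rightarrow> 'a"
    interpret ev: comm_ring_hom ?ev by (rule comm_ring_hom_eval_mpoly)
    have "det (map_mat ?ev ?B) \<noteq> 0"
    proof (rule det_diagonal_ne_0[of _ d1])
      fix j c assume "j < d1" "c < d1"
      then show "map_mat ?ev ?B $$ (j, c) = 0 \<longleftrightarrow> j \<noteq> c"
        using assms(2,4)
        by (auto simp: right_factor_def dims generic_W_def eval_mpoly_mult eval_mpoly_Var ev.hom_of_nat)
    qed simp
    then show ?thesis by (metis ev.hom_det ev.hom_zero)
  qed
  then show ?thesis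
    using mat_rank_coeff_matrix[of ?W1 ?W2, unfolded dims] indep assms
    by (simp add: M_matrix_def)
qed

end
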